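(* Let $R$ be a unitary commutative $\mathbb{R}$-algebra with $\mathcal{X}_R=\mathrm{Hom}(R,\mathbb{R})$ nonempty, let $d\ge1$ be an integer, and let $M\subseteq R$ be a $\sum R^{2d}$-module of $R$. Then $$\overline{M}^{\,\mathcal{T}_{\mathcal{X}_R}}=\mathrm{Psd}(\mathcal{K}_M).$$
   Context: $\mathcal{X}_R=\mathrm{Hom}(R,\mathbb{R})$ is the set of unitary homomorphisms $\alpha:R\to\mathbb{R}$. $\sum R^{2d}$ is the set of finite sums of $2d$-th powers of elements of $R$. A subset $M\subseteq R$ is a $\sum R^{2d}$-module if $1\in M$, $M+M\subseteq M$ and $\sum R^{2d}\cdot M\subseteq M$. $\mathcal{K}_M:=\{\alpha\in\mathcal{X}_R:\alpha(a)\ge0\ \text{for all } a\in M\}$. For $K\subseteq\mathcal{X}_R$, $\mathrm{Psd}(K):=\{a\in R:\alpha(a)\ge0\text{ for all }\alpha\in K\}$ (so $\mathrm{Psd}(\emptyset)=R$). $\mathcal{T}_{\mathcal{X}_R}$ is the topology on $R$ generated by the seminorms $\rho_\alpha(a)=|\alpha(a)|$, $\alpha\in\mathcal{X}_R$: a neighborhood basis at $a$ is given by the sets $\{b\in R:|\alpha_i(a-b)|<\epsilon,\ i=1,\dots,m\}$ with $\epsilon>0$ and $\alpha_1,\dots,\alpha_m\in\mathcal{X}_R$. The overline denotes closure in this topology. *)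

theory Defs
  imports "HOL-Analysis.Analysis"
begin

text \<open>
  Unitary commutative real algebras are the types of sort \<open>{real_algebra_1, comm_ring_1}\<close>.
  This sort excludes the zero ring, which has no unitary homomorphism to the reals.
\<close>

definition unital_hom :: "('a::{real_algebra_1,comm_ring_1} \<Rightarrow> real) \<Rightarrow> bool" where
  "unital_hom \<alpha> \<longleftrightarrow>
     linear \<alpha> \<and> (\<forall>a b. \<alpha> (a * b) = \<alpha> a * \<alpha> b) \<and> \<alpha> 1 = 1"

definition characters :: "('a::{real_algebra_1,comm_ring_1} \<Rightarrow> real) set" where
  "characters = {\<alpha>. unital_hom \<alpha>}"

text \<open>Real-linearity is automatic: every unitary ring homomorphism to the reals is a character.\<close>

lemma unital_hom_iff_ring_hom:
  fixes \<alpha> :: "'a::{real_algebra_1,comm_ring_1} \<Rightarrow> real"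
  shows "unital_hom \<alpha> \<longleftrightarrow>
    (\<forall>a b. \<alpha> (a + b) = \<alpha> a + \<alpha> b) \<and> (\<forall>a b. \<alpha> (a * b) = \<alpha> a * \<alpha> b) \<and> \<alpha> 1 = 1"
    (is "_ \<longleftrightarrow> ?R")
proof
  assume "unital_hom \<alpha>"
  then show ?R
    by (auto simp: unital_hom_def linear_add)
next
  assume R: ?R
  then have add: "\<alpha> (a + b) = \<alpha> a + \<alpha> b" and mult: "\<alpha> (a * b) = \<alpha> a * \<alpha> b"
    and one: "\<alpha> 1 = 1" for a b
    by auto
  interpret additive \<alpha>
    by standard (rule add)
  have nat: "\<alpha> (of_nat n) = of_nat n" for n
    by (induction n) (auto simp: zero add one)
  have int: "\<alpha> (of_int k) = of_int k" for k
    by (cases k rule: int_cases2) (auto simp: nat minus)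
  define g where "g r = \<alpha> (of_real r)" for r
  have g_add: "g (r + s) = g r + g s" and g_mult: "g (r * s) = g r * g s" for r s
    by (auto simp: g_def add mult)
  have g_diff: "g (r - s) = g r - g s" for r s
    by (simp add: g_def diff)
  have g_int: "g (of_int k) = of_int k" for k
    by (simp add: g_def int)
  have g_rat: "g q = q" if rat: "q \<in> \<rat>" for q
  proof -
    obtain m n where q: "q = of_int m / of_int n" "(n::int) \<noteq> 0"
      using rat by (auto simp: Rats_eq_int_div_int)
    have "g q * of_int n = g (q * of_int n)"
      by (simp add: g_mult g_int)
    also have "\<dots> = of_int m"
      using q by (simp add: g_int)
    also have "\<dots> = q * of_int n"
      using q by simp
    finally show ?thesis
      using q(2) by simp
  qed
  have g_nonneg: "0 \<le> g r" if "0 \<le> r" for r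
    using g_mult[of "sqrt r" "sqrt r"] that by simp
  have g_mono: "g r \<le> g s" if "r \<le> s" for r s
    using g_nonneg[of "s - r"] that by (simp add: g_diff)
  have g_id: "g r = r" for r
  proof (rule antisym)
    show "g r \<le> r"
    proof (rule ccontr)
      assume "\<not> g r \<le> r"
      then obtain q where "q \<in> \<rat>" "r < q" "q < g r"
        using Rats_dense_in_real[of r "g r"] by auto
      then show False
        using g_mono[of r q] g_rat[of q] by simp
    qed
    show "r \<le> g r"
    proof (rule ccontr)
      assume "\<not> r \<le> g r"
      then obtain q where "q \<in> \<rat>" "g r < q" "q < r"
        using Rats_dense_in_real[of "g r" r] by auto
      then show False
        using g_mono[of q r] g_rat[of q] by simp
    qed
  qed
  have "\<alpha> (r *\<^sub>R a) = r *\<^sub>R \<alpha> a" for r a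
    using g_id[of r] by (simp add: scaleR_conv_of_real mult g_def)
  then have "linear \<alpha>"
    by (intro linearI) (auto simp: add)
  then show "unital_hom \<alpha>"
    using mult one by (simp add: unital_hom_def)
qed

definition sums_of_powers :: "nat \<Rightarrow> 'a::comm_ring_1 set" where
  "sums_of_powers k = {\<Sum>i<n. x i ^ k | (n::nat) x. True}"

definition sum_powers_module :: "nat \<Rightarrow> 'a::comm_ring_1 set \<Rightarrow> bool" where
  "sum_powers_module k M \<longleftrightarrow>
     1 \<in> M \<and>
     (\<forall>a\<in>M. \<forall>b\<in>M. a + b \<in> M) \<and>
     (\<forall>s\<in>sums_of_powers k. \<forall>a\<in>M. s * a \<in> M)"

definition nonneg_characters ::
    "'a::{real_algebra_1,comm_ring_1} set \<Rightarrow> ('a \<Rightarrow> real) set" where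
  "nonneg_characters M = {\<alpha> \<in> characters. \<forall>a\<in>M. 0 \<le> \<alpha> a}"

definition Psd :: "('a \<Rightarrow> real) set \<Rightarrow> 'a set" where
  "Psd K = {a. \<forall>\<alpha>\<in>K. 0 \<le> \<alpha> a}"

definition character_ball ::
    "('a::{real_algebra_1,comm_ring_1} \<Rightarrow> real) set \<Rightarrow> real \<Rightarrow> 'a \<Rightarrow> 'a set" where
  "character_ball F \<epsilon> a = {b. \<forall>\<alpha>\<in>F. \<bar>\<alpha> (a - b)\<bar> < \<epsilon>}"

definition character_topology :: "'a::{real_algebra_1,comm_ring_1} topology" where
  "character_topology = topology (\<lambda>U. \<forall>a\<in>U. \<exists>F \<epsilon>.
     finite F \<and> F \<subseteq> characters \<and> 0 < \<epsilon> \<and> character_ball F \<epsilon> a \<subseteq> U)"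

lemma openin_character_topology:
  fixes U :: "'a::{real_algebra_1,comm_ring_1} set"
  shows "openin character_topology U \<longleftrightarrow> (\<forall>a\<in>U. \<exists>F \<epsilon>.
     finite F \<and> F \<subseteq> characters \<and> 0 < \<epsilon> \<and> character_ball F \<epsilon> a \<subseteq> U)"
proof -
  let ?P = "\<lambda>(a :: 'a) U. \<exists>F \<epsilon>. finite F \<and> F \<subseteq> characters \<and> 0 < \<epsilon> \<and> character_ball F \<epsilon> a \<subseteq> U"
  have inter: "?P a (S \<inter> T)" if S: "?P a S" and T: "?P a T" for a and S T :: "'a set"
  proof -
    obtain F \<epsilon> where F: "finite F" "F \<subseteq> characters" "0 < \<epsilon>" "character_ball F \<epsilon> a \<subseteq> S"
      using S by blast
    obtain G \<delta> where G: "finite G" "G \<subseteq> characters" "0 < \<delta>" "character_ball G \<delta> a \<subseteq> T"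
      using T by blast
    have "character_ball (F \<union> G) (min \<epsilon> \<delta>) a \<subseteq> character_ball F \<epsilon> a \<inter> character_ball G \<delta> a"
      by (auto simp: character_ball_def)
    then show ?thesis
      using F G by (intro exI[of _ "F \<union> G"] exI[of _ "min \<epsilon> \<delta>"]) auto
  qed
  have "istopology (\<lambda>U. \<forall>a\<in>U. ?P a U)"
    unfolding istopology_def
  proof (intro conjI allI impI ballI)
    fix S T :: "'a set" and a
    assume "\<forall>a\<in>S. ?P a S" "\<forall>a\<in>T. ?P a T" "a \<in> S \<inter> T"
    then show "?P a (S \<inter> T)"
      by (intro inter) auto
  next
    fix \<U> :: "'a set set" and a
    assume U: "\<forall>U\<in>\<U>. \<forall>a\<in>U. ?P a U" and "a \<in> \<Union>\<U>"
    then obtain V where "V \<in> \<U>" "a \<in> V"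
      by auto
    have "?P a V"
      by (rule U[THEN bspec, THEN bspec]) fact+
    then obtain F \<epsilon> where "finite F" "F \<subseteq> characters" "0 < \<epsilon>" "character_ball F \<epsilon> a \<subseteq> V"
      by (elim exE conjE)
    then show "?P a (\<Union>\<U>)"
      using \<open>V \<in> \<U>\<close> by (intro exI[of _ F] exI[of _ \<epsilon>]) auto
  qed
  then show ?thesis
    unfolding character_topology_def by (simp add: topology_inverse')
qed

lemma topspace_character_topology [simp]: "topspace character_topology = UNIV"
proof -
  have "openin character_topology UNIV"
    unfolding openin_character_topology
    by (intro ballI exI[of _ "{}"] exI[of _ "1::real"]) auto
  then show ?thesis
    using openin_subset by blast
qed

text \<open>The balls are themselves open, so they do form a neighbourhood basis.\<close>

lemma openin_character_ball:
  assumes "finite F" "F \<subseteq> characters"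
  shows "openin character_topology (character_ball F \<epsilon> a)"
  unfolding openin_character_topology
proof
  fix b
  assume b: "b \<in> character_ball F \<epsilon> a"
  define \<delta> where "\<delta> = Min (insert 1 ((\<lambda>\<alpha>. \<epsilon> - \<bar>\<alpha> (a - b)\<bar>) ` F))"
  have "0 < \<delta>"
    using assms b by (auto simp: \<delta>_def character_ball_def)
  have "character_ball F \<delta> b \<subseteq> character_ball F \<epsilon> a"
  proof
    fix c
    assume c: "c \<in> character_ball F \<delta> b"
    have "\<bar>\<alpha> (a - c)\<bar> < \<epsilon>" if "\<alpha> \<in> F" for \<alpha>
    proof -
      have "linear \<alpha>"
        using assms(2) that by (auto simp: characters_def unital_hom_def)
      then have "\<alpha> (a - c) = \<alpha> (a - b) + \<alpha> (b - c)"
        by (simp add: linear_diff)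
      moreover have "\<delta> \<le> \<epsilon> - \<bar>\<alpha> (a - b)\<bar>"
        unfolding \<delta>_def using assms(1) that by (intro Min_le) auto
      moreover have "\<bar>\<alpha> (b - c)\<bar> < \<delta>"
        using c that by (auto simp: character_ball_def)
      ultimately show ?thesis
        by linarith
    qed
    then show "c \<in> character_ball F \<epsilon> a"
      by (simp add: character_ball_def)
  qed
  then show "\<exists>G \<delta>. finite G \<and> G \<subseteq> characters \<and> 0 < \<delta> \<and> character_ball G \<delta> b \<subseteq> character_ball F \<epsilon> a"
    using assms \<open>0 < \<delta>\<close> by blast
qed

end

theory Submission imports Defs begin

text \<open>
  Interpolation at finitely many distinct characters produces elements equal to 1 at one of
  them and 0 at the others.  Multiplying a suitable element of \<open>M\<close> by the \<open>2d\<close>-th power of such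
  an element adjusts one value at a time, so every nonnegative element agrees on each finite set
  of characters with an element of \<open>M\<close>.  A negative prescribed value at \<open>\<alpha>\<close> arises only when \<open>\<alpha>\<close>
  itself is negative somewhere on \<open>M\<close>.
\<close>

lemma character_simps:
  assumes "\<alpha> \<in> characters"
  shows "\<alpha> 0 = 0" "\<alpha> 1 = 1" "\<alpha> (a + b) = \<alpha> a + \<alpha> b" "\<alpha> (a - b) = \<alpha> a - \<alpha> b"
    "\<alpha> (a * b) = \<alpha> a * \<alpha> b" "\<alpha> (r *\<^sub>R a) = r * \<alpha> a"
  using assms
  by (auto simp: characters_def unital_hom_def linear_0 linear_add linear_diff linear_scale)

lemma character_power:
  assumes "\<alpha> \<in> characters"
  shows "\<alpha> (a ^ n) = \<alpha> a ^ n"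
  by (induction n) (simp_all add: character_simps[OF assms])

text \<open>Induction on \<open>F\<close>: each character to be avoided contributes one factor
  vanishing at it and equal to 1 at \<open>\<alpha>\<close>. Multiplicativity keeps the zeros
  already obtained.\<close>

lemma character_separating_element:
  assumes "finite F" "F \<subseteq> characters" "\<alpha> \<in> characters" "\<alpha> \<notin> F"
  shows "\<exists>e. \<alpha> e = 1 \<and> (\<forall>\<beta>\<in>F. \<beta> e = 0)"
  using assms
proof (induction F rule: finite_induct)
  case empty
  then show ?case
    using character_simps(2) by blast
next
  case (insert \<gamma> F)
  then obtain e where e: "\<alpha> e = 1" "\<forall>\<beta>\<in>F. \<beta> e = 0"
    by auto
  obtain c where c: "\<alpha> c \<noteq> \<gamma> c"
    using insert.prems(3) by (auto simp: fun_eq_iff)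
  \<comment> \<open>Subtracting the constant \<open>\<gamma> c\<close> kills the value at
    \<open>\<gamma>\<close>; the scaling then makes the value at \<open>\<alpha>\<close> equal to
    1.\<close>
  define f where "f = (1 / (\<alpha> c - \<gamma> c)) *\<^sub>R (c - \<gamma> c *\<^sub>R 1)"
  have \<gamma>: "\<gamma> \<in> characters"
    using insert.prems by simp
  have "\<alpha> f = 1"
    using c insert.prems by (simp add: f_def character_simps)
  moreover have "\<gamma> f = 0"
    by (simp add: f_def character_simps[OF \<gamma>])
  ultimately have "\<alpha> (e * f) = 1" "\<forall>\<beta>\<in>insert \<gamma> F. \<beta> (e * f) = 0"
    using e insert.prems by (auto simp: character_simps subset_iff)
  then show ?case
    by blast
qed

lemma power_in_sums_of_powers: "x ^ k \<in> sums_of_powers k"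
  unfolding sums_of_powers_def
  by (rule CollectI, rule exI[of _ 1], rule exI[of _ "\<lambda>_. x"]) simp

lemma zero_in_sums_of_powers: "0 \<in> sums_of_powers k"
  unfolding sums_of_powers_def by (rule CollectI, rule exI[of _ 0]) simp

lemma sum_powers_module_sum:
  assumes M: "sum_powers_module k M" and "\<And>i. i \<in> I \<Longrightarrow> f i \<in> M"
  shows "sum f I \<in> M"
proof -
  \<comment> \<open>The empty sum of powers is 0, so \<open>M\<close> contains 0. This settles the
    empty index set and the infinite one, where \<open>sum\<close> defaults to 0.\<close>
  have "0 * 1 \<in> M"
    using M zero_in_sums_of_powers unfolding sum_powers_module_def by blast
  then have "0 \<in> M"
    by simp
  with assms(2) show ?thesis
    by (induction I rule: infinite_finite_induct)
      (use M in \<open>auto simp: sum_powers_module_def\<close>)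
qed

lemma character_sum:
  assumes "\<alpha> \<in> characters"
  shows "\<alpha> (sum f I) = (\<Sum>i\<in>I. \<alpha> (f i))"
  by (induction I rule: infinite_finite_induct) (simp_all add: character_simps[OF assms])

lemma sum_powers_module_single_value:
  fixes M :: "'a::{real_algebra_1,comm_ring_1} set"
  assumes M: "sum_powers_module k M" and "0 < k"
    and F: "finite F" "F \<subseteq> characters" "\<alpha> \<in> F"
    and a: "a \<in> Psd (nonneg_characters M)"
  shows "\<exists>m\<in>M. \<forall>\<beta>\<in>F. \<beta> m = (if \<beta> = \<alpha> then \<alpha> a else 0)"
proof -
  have \<alpha>: "\<alpha> \<in> characters"
    using F by auto
  obtain e where e: "\<alpha> e = 1" "\<forall>\<beta>\<in>F - {\<alpha>}. \<beta> e = 0"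
    using character_separating_element[of "F - {\<alpha>}" \<alpha>] F by auto
  \<comment> \<open>The quotient has to be nonnegative in order to be a \<open>k\<close>-th power of
    its real root, so the sign of \<open>\<alpha> m\<close> is chosen to fit that of
    \<open>\<alpha> a\<close>.\<close>
  obtain m where m: "m \<in> M" "\<alpha> m \<noteq> 0" "0 \<le> \<alpha> a / \<alpha> m"
  proof (cases "0 \<le> \<alpha> a")
    case True
    have "1 \<in> M"
      using M by (simp add: sum_powers_module_def)
    then show ?thesis
      using that[of 1] True by (simp add: character_simps[OF \<alpha>])
  next
    case False
    then have "\<alpha> \<notin> nonneg_characters M"
      using a by (auto simp: Psd_def)
    then obtain m where "m \<in> M" "\<alpha> m < 0"
      using \<alpha> by (auto simp: nonneg_characters_def not_le)
    then show ?thesis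
      using that[of m] False by (simp add: divide_nonpos_neg)
  qed
  \<comment> \<open>At \<open>\<alpha>\<close> the power equals
    \<open>\<alpha> a / \<alpha> m\<close>, which turns \<open>\<alpha> m\<close> into
    \<open>\<alpha> a\<close>. At the rest of \<open>F\<close> it vanishes with \<open>e\<close>,
    because \<open>k\<close> is positive.\<close>
  define b where "b = (root k (\<alpha> a / \<alpha> m) *\<^sub>R e) ^ k * m"
  have "b \<in> M"
    unfolding b_def using M m(1) power_in_sums_of_powers
    unfolding sum_powers_module_def by blast
  moreover have "\<beta> b = (if \<beta> = \<alpha> then \<alpha> a else 0)" if "\<beta> \<in> F" for \<beta>
  proof -
    have \<beta>: "\<beta> \<in> characters"
      using F that by auto
    show ?thesis
      using e that m(2,3) \<open>0 < k\<close>
      by (auto simp: b_def character_simps[OF \<beta>] character_power[OF \<beta>] real_root_pow_pos2)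
  qed
  ultimately show ?thesis
    by blast
qed

text \<open>The single-value elements for all members of \<open>F\<close> are added up; at each
  character of \<open>F\<close> exactly one summand survives.\<close>

lemma sum_powers_module_interpolation:
  fixes M :: "'a::{real_algebra_1,comm_ring_1} set"
  assumes M: "sum_powers_module k M" and "0 < k"
    and F: "finite F" "F \<subseteq> characters"
    and a: "a \<in> Psd (nonneg_characters M)"
  shows "\<exists>b\<in>M. \<forall>\<beta>\<in>F. \<beta> b = \<beta> a"
proof -
  obtain m where m: "\<And>\<alpha>. \<alpha> \<in> F \<Longrightarrow> m \<alpha> \<in> M"
    "\<And>\<alpha> \<beta>. \<alpha> \<in> F \<Longrightarrow> \<beta> \<in> F \<Longrightarrow> \<beta> (m \<alpha>) = (if \<beta> = \<alpha> then \<alpha> a else 0)"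
    using sum_powers_module_single_value[OF M \<open>0 < k\<close> F _ a] by metis
  have "\<beta> (sum m F) = \<beta> a" if "\<beta> \<in> F" for \<beta>
  proof -
    have "\<beta> (sum m F) = (\<Sum>\<alpha>\<in>F. \<beta> (m \<alpha>))"
      using F that by (intro character_sum) auto
    also have "\<dots> = (\<Sum>\<alpha>\<in>F. if \<beta> = \<alpha> then \<alpha> a else 0)"
      using m(2) that by (intro sum.cong) auto
    also have "\<dots> = \<beta> a"
      using F(1) that by simp
    finally show ?thesis .
  qed
  then show ?thesis
    by (intro bexI[of _ "sum m F"] ballI sum_powers_module_sum[OF M] m(1))
qed

text \<open>Balls suffice as test sets: they are open and contain their centre, and every open set
  contains a ball around each of its points.\<close>

lemma in_closure_of_character_topology:
  "a \<in> character_topology closure_of S \<longleftrightarrow>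
    (\<forall>F \<epsilon>. finite F \<and> F \<subseteq> characters \<and> 0 < \<epsilon> \<longrightarrow> S \<inter> character_ball F \<epsilon> a \<noteq> {})"
    (is "_ \<longleftrightarrow> ?R")
proof
  assume a: "a \<in> character_topology closure_of S"
  show ?R
  proof (intro allI impI)
    fix F :: "('a \<Rightarrow> real) set" and \<epsilon> :: real
    assume F: "finite F \<and> F \<subseteq> characters \<and> 0 < \<epsilon>"
    then have "a \<in> character_ball F \<epsilon> a"
      by (auto simp: character_ball_def character_simps subset_iff)
    then show "S \<inter> character_ball F \<epsilon> a \<noteq> {}"
      using a F openin_character_ball[of F \<epsilon> a] by (auto simp: in_closure_of)
  qed
next
  assume ?R
  then show "a \<in> character_topology closure_of S"
    unfolding in_closure_of openin_character_topology
  proof (intro conjI allI impI)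
    fix T
    assume "a \<in> T \<and> (\<forall>a\<in>T. \<exists>F \<epsilon>. finite F \<and> F \<subseteq> characters \<and> 0 < \<epsilon> \<and>
      character_ball F \<epsilon> a \<subseteq> T)"
    then obtain F \<epsilon> where "finite F \<and> F \<subseteq> characters \<and> 0 < \<epsilon>" "character_ball F \<epsilon> a \<subseteq> T"
      by meson
    with \<open>?R\<close> show "\<exists>y. y \<in> S \<and> y \<in> T"
      by (metis disjoint_iff subset_iff)
  qed simp
qed

theorem theorem5p5:
  fixes M :: "'a::{real_algebra_1,comm_ring_1} set" and d :: nat
  assumes "(characters :: ('a \<Rightarrow> real) set) \<noteq> {}"
    and "1 \<le> d"
    and "sum_powers_module (2 * d) M"
  shows "character_topology closure_of M = Psd (nonneg_characters M)"
proof (intro equalityI subsetI)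
  fix a
  assume a: "a \<in> character_topology closure_of M"
  have "0 \<le> \<alpha> a" if "\<alpha> \<in> nonneg_characters M" for \<alpha>
  proof (rule ccontr)
    assume neg: "\<not> 0 \<le> \<alpha> a"
    have \<alpha>: "\<alpha> \<in> characters" "\<forall>b\<in>M. 0 \<le> \<alpha> b"
      using that by (auto simp: nonneg_characters_def)
    \<comment> \<open>With radius \<open>- \<alpha> a\<close>, every element of the ball still has a
      negative value at \<open>\<alpha>\<close>, which no element of \<open>M\<close> has.\<close>
    have "M \<inter> character_ball {\<alpha>} (- \<alpha> a) a \<noteq> {}"
      using a[unfolded in_closure_of_character_topology, rule_format, of "{\<alpha>}" "- \<alpha> a"] \<alpha>(1) neg
      by simp
    then obtain b where "b \<in> M" "\<bar>\<alpha> a - \<alpha> b\<bar> < - \<alpha> a"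
      by (auto simp: character_ball_def character_simps[OF \<alpha>(1)])
    with \<alpha>(2) show False
      by fastforce
  qed
  then show "a \<in> Psd (nonneg_characters M)"
    by (simp add: Psd_def)
next
  fix a
  assume a: "a \<in> Psd (nonneg_characters M)"
  show "a \<in> character_topology closure_of M"
    unfolding in_closure_of_character_topology
  proof (intro allI impI)
    fix F :: "('a \<Rightarrow> real) set" and \<epsilon> :: real
    assume F: "finite F \<and> F \<subseteq> characters \<and> 0 < \<epsilon>"
    \<comment> \<open>Exact agreement on \<open>F\<close> puts \<open>b\<close> into the ball for
      every positive \<open>\<epsilon>\<close>. The exponent \<open>2 * d\<close> is positive since
      \<open>1 \<le> d\<close>.\<close>
    then obtain b where b: "b \<in> M" "\<forall>\<beta>\<in>F. \<beta> b = \<beta> a"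
      using sum_powers_module_interpolation[OF assms(3) _ _ _ a, of F] assms(2) by auto
    then have "b \<in> character_ball F \<epsilon> a"
      using F by (auto simp: character_ball_def character_simps subset_iff)
    with b(1) show "M \<inter> character_ball F \<epsilon> a \<noteq> {}"
      by blast
  qed
qed

end
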